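(* For each integer $d \geq 3$, there exist a $(d+1)$-dimensional polytope $P \subset \mathbb{R}^{d+1}$ with $(2d+1)(d+1)+1$ facets and a linear objective function $\mathbf{x} \mapsto \mathbf{c}^{\top}\mathbf{x}$ on $\mathbb{R}^{d+1}$ such that every coherent monotone path on $P$ with respect to $\mathbf{c}$ has length at least $2^{d-1}-1$.
   Context: Let $P \subset \mathbb{R}^{n}$ be a polytope and $\mathbf{c} \in \mathbb{R}^{n}$. A monotone path (with respect to $\mathbf{c}$) is a path in the graph (vertices and edges) of $P$ from some minimizer of $\mathbf{c}^{\top}\mathbf{x}$ over $P$ to some maximizer, along which $\mathbf{c}^{\top}\mathbf{x}$ strictly increases at each step. Given $\mathbf{w} \in \mathbb{R}^n$ linearly independent of $\mathbf{c}$, consider the set of all faces of $P$ that are the set of maximizers of $(\mathbf{w}+\lambda \mathbf{c})^{\top}\mathbf{x}$ over $P$ for some $\lambda \in \mathbb{R}$. If these faces are all vertices or edges (which is the case for generic $\mathbf{w}$), they form a monotone path, and a monotone path arising in this way from some $\mathbf{w}$ is called a coherent monotone path with respect to $\mathbf{c}$. The length of a path is its number of edges. *)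

theory Defs
  imports "HOL-Analysis.Analysis"
begin

definition maximizers :: "'a::euclidean_space set \<Rightarrow> 'a \<Rightarrow> 'a set" where
  "maximizers P u = {x. is_arg_max (\<lambda>y. u \<bullet> y) (\<lambda>y. y \<in> P) x}"

definition minimizers :: "'a::euclidean_space set \<Rightarrow> 'a \<Rightarrow> 'a set" where
  "minimizers P u = {x. is_arg_min (\<lambda>y. u \<bullet> y) (\<lambda>y. y \<in> P) x}"

text \<open>A path in the graph of \<open>P\<close> is represented by the nonempty list of the vertices it visits.\<close>

definition monotone_path :: "'a::euclidean_space set \<Rightarrow> 'a \<Rightarrow> 'a list \<Rightarrow> bool" where
  "monotone_path P c vs \<longleftrightarrow>
     vs \<noteq> [] \<and>
     (\<forall>v \<in> set vs. v extreme_point_of P) \<and>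
     successively (\<lambda>u v. closed_segment u v edge_of P \<and> c \<bullet> u < c \<bullet> v) vs \<and>
     hd vs \<in> minimizers P c \<and>
     last vs \<in> maximizers P c"

definition path_edges :: "'a::euclidean_space list \<Rightarrow> 'a set set" where
  "path_edges vs = {closed_segment (vs ! i) (vs ! Suc i) | i. Suc i < length vs}"

definition path_length :: "'a list \<Rightarrow> nat" where
  "path_length vs = length vs - 1"

definition parametric_faces :: "'a::euclidean_space set \<Rightarrow> 'a \<Rightarrow> 'a \<Rightarrow> 'a set set" where
  "parametric_faces P c w = {maximizers P (w + lambda *\<^sub>R c) | lambda. lambda \<in> (UNIV :: real set)}"

text \<open>The inequality \<open>w \<noteq> c\<close> is needed because \<open>independent\<close> is a predicate on sets, and
  \<open>{w, c}\<close> collapses to a singleton when \<open>w = c\<close>. Vertices occur among the parametric faces as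
  singletons. That every parametric face is a vertex or an edge of \<open>P\<close> follows from the final
  equation together with \<open>monotone_path P c vs\<close>.\<close>

definition coherent_monotone_path :: "'a::euclidean_space set \<Rightarrow> 'a \<Rightarrow> 'a list \<Rightarrow> bool" where
  "coherent_monotone_path P c vs \<longleftrightarrow>
     monotone_path P c vs \<and>
     (\<exists>w. w \<noteq> c \<and> independent {w, c} \<and>
          parametric_faces P c w = (\<lambda>v. {v}) ` set vs \<union> path_edges vs)"

end

theory Submission
  imports Defs
begin

text \<open>
  Take coordinates \<open>y\<^sub>0, \<dots>, y\<^sub>d\<close> in which \<open>y\<^sub>d\<close> is the objective, and let a \<^emph>\<open>tower\<close> be the
  Klee--Minty-like polyhedron \<open>y\<^sub>0 \<le> 1\<close>, \<open>\<bar>y\<^sub>k\<bar> \<le> 5\<^sup>k - 2 y\<^sub>k\<^sub>-\<^sub>1\<close>, which has \<open>2d + 1\<close> facets and \<open>2\<^sup>d\<close>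
  vertices, one for each sign pattern. Maximizing \<open>\<Sum>\<omega>\<^sub>k y\<^sub>k\<close> over it eliminates \<open>y\<^sub>d, y\<^sub>d\<^sub>-\<^sub>1, \<dots>\<close> in turn,
  the coefficient of \<open>y\<^sub>k\<^sub>-\<^sub>1\<close> becoming \<open>\<omega>\<^sub>k\<^sub>-\<^sub>1 - 2\<bar>\<nu>\<^sub>k\<bar>\<close> when that of \<open>y\<^sub>k\<close> is \<open>\<nu>\<^sub>k\<close>. This is a tent map,
  so if \<open>0 < \<omega>\<^sub>0 \<le> \<dots> \<le> \<omega>\<^sub>d\<^sub>-\<^sub>1\<close>, every sign pattern arises from some value of the free coefficient \<open>\<omega>\<^sub>d\<close>:
  coherent paths for all \<open>w\<close> in a full-dimensional cone visit all \<open>2\<^sup>d\<close> vertices.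

  With the objective \<open>\<Sum>x\<^sub>i\<close>, the \<open>d + 1\<close> cones of those \<open>w\<close> whose \<open>i\<close>-th entry is maximal cover
  everything, and each is contained in such a cone for suitable coordinates. Place a tiny copy of the
  tower for the \<open>i\<close>-th cone at a point \<open>p\<^sub>i\<close>, sheared by a large multiple of the objective, in such
  a way that each \<open>p\<^sub>j\<close> lies in the interior of the tower at \<open>p\<^sub>i\<close> whenever \<open>j \<noteq> i\<close>. The
  intersection of the towers, cut off by one horizontal hyperplane at the bottom, is the required
  polytope; near \<open>p\<^sub>i\<close> it coincides with the \<open>i\<close>-th tower.
\<close>

section \<open>Polyhedra, maximizers and coherent paths\<close>

lemma eventually_affine_less:
  fixes a b c :: real
  assumes "a < c"
  shows "\<forall>\<^sub>F t in at_right 0. a + t * b < c"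
proof -
  have "((\<lambda>t. a + t * b) \<longlongrightarrow> a + 0 * b) (at_right 0)"
    by (intro tendsto_intros)
  with assms show ?thesis
    by (intro order_tendstoD(2)[where y = "a + 0 * b"]) auto
qed

lemma bounded_if_inner_bounded_above:
  fixes S :: "'a::euclidean_space set"
  assumes "\<And>u. \<exists>C. \<forall>x\<in>S. u \<bullet> x \<le> C"
  shows "bounded S"
proof -
  obtain C where C: "\<And>u x. x \<in> S \<Longrightarrow> u \<bullet> x \<le> C u"
    using assms by metis
  have "S \<subseteq> cbox (\<Sum>b\<in>Basis. - C (- b) *\<^sub>R b) (\<Sum>b\<in>Basis. C b *\<^sub>R b)"
  proof
    fix x assume "x \<in> S"
    show "x \<in> cbox (\<Sum>b\<in>Basis. - C (- b) *\<^sub>R b) (\<Sum>b\<in>Basis. C b *\<^sub>R b)"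
      unfolding mem_box
    proof
      fix b :: 'a assume "b \<in> Basis"
      with C[OF \<open>x \<in> S\<close>, of b] C[OF \<open>x \<in> S\<close>, of "- b"]
      show "(\<Sum>b\<in>Basis. - C (- b) *\<^sub>R b) \<bullet> b \<le> x \<bullet> b \<and> x \<bullet> b \<le> (\<Sum>b\<in>Basis. C b *\<^sub>R b) \<bullet> b"
        by (simp only: inner_sum_left_Basis) (simp add: inner_commute)
    qed
  qed
  then show ?thesis
    using bounded_cbox bounded_subset by blast
qed

lemma irredundant_halfspaces_polytope:
  fixes n :: "'j \<Rightarrow> 'a::euclidean_space" and \<beta> :: "'j \<Rightarrow> real"
    and J :: "'j set"
  defines "P \<equiv> {x. \<forall>j\<in>J. n j \<bullet> x \<le> \<beta> j}"
  assumes fin: "finite J" and bdd: "bounded P"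
    and interior_pt: "\<And>j. j \<in> J \<Longrightarrow> n j \<bullet> q\<^sub>0 < \<beta> j"
    and facet_pt: "\<And>j. j \<in> J \<Longrightarrow> n j \<bullet> q j = \<beta> j"
      "\<And>j l. j \<in> J \<Longrightarrow> l \<in> J \<Longrightarrow> l \<noteq> j \<Longrightarrow> n l \<bullet> q j < \<beta> l"
  shows "polytope P" "aff_dim P = DIM('a)" "card {F. F facet_of P} = card J"
proof -
  define H where "H j = {x. n j \<bullet> x \<le> \<beta> j}" for j
  define G where "G j = P \<inter> {x. n j \<bullet> x = \<beta> j}" for j
  have P_eq: "P = \<Inter>(H ` J)"
    by (auto simp: P_def H_def)
  have n_nz: "n j \<noteq> 0" if "j \<in> J" for j
    using interior_pt[OF that] facet_pt(1)[OF that] by auto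
  have "polyhedron P"
    unfolding P_eq H_def using fin by (auto simp: polyhedron_halfspace_le)
  then show "polytope P"
    using bdd by (simp add: polytope_eq_bounded_polyhedron)
  have opn: "open {x. \<forall>j\<in>J. n j \<bullet> x < \<beta> j}"
  proof -
    have "{x. \<forall>j\<in>J. n j \<bullet> x < \<beta> j} = (\<Inter>j\<in>J. {x. n j \<bullet> x < \<beta> j})" by auto
    then show ?thesis using fin by (auto simp: open_halfspace_lt)
  qed
  have "q\<^sub>0 \<in> interior P"
    by (rule interiorI[OF opn]) (auto simp: interior_pt P_def intro: less_imp_le)
  then have int: "interior P \<noteq> {}" by blast
  then show "aff_dim P = DIM('a)"
    by (rule aff_dim_nonempty_interior)
  have hull: "affine hull P = UNIV"
    using int by (rule affine_hull_nonempty_interior)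
  have beyond: "\<exists>r. n j \<bullet> r > \<beta> j \<and> (\<forall>l\<in>J. l \<noteq> j \<longrightarrow> n l \<bullet> r < \<beta> l)" if "j \<in> J" for j
  proof -
    have "\<forall>\<^sub>F t in at_right 0. \<forall>l\<in>J. l \<noteq> j \<longrightarrow> n l \<bullet> q j + t * (n l \<bullet> n j) < \<beta> l"
      using fin facet_pt(2)[OF that]
      by (intro eventually_ball_finite ballI) (auto intro!: eventually_affine_less)
    moreover have "\<forall>\<^sub>F t in at_right (0::real). 0 < t"
      by (simp add: eventually_at_right_less)
    ultimately have "\<forall>\<^sub>F t in at_right 0.
        0 < t \<and> (\<forall>l\<in>J. l \<noteq> j \<longrightarrow> n l \<bullet> q j + t * (n l \<bullet> n j) < \<beta> l)"
      by eventually_elim auto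
    then obtain t :: real where "0 < t" "\<forall>l\<in>J. l \<noteq> j \<longrightarrow> n l \<bullet> q j + t * (n l \<bullet> n j) < \<beta> l"
      using eventually_happens'[OF trivial_limit_at_right_real] by blast
    then show ?thesis
      using facet_pt(1)[OF that] n_nz[OF that]
      by (intro exI[of _ "q j + t *\<^sub>R n j"]) (auto simp: inner_add_right)
  qed
  have H_inj: "j = l" if jl: "j \<in> J" "l \<in> J" "H j = H l" for j l
  proof (rule ccontr)
    obtain r where r: "n j \<bullet> r > \<beta> j" "\<forall>l\<in>J. l \<noteq> j \<longrightarrow> n l \<bullet> r < \<beta> l"
      using beyond[OF jl(1)] by blast
    assume "j \<noteq> l"
    with r(2) jl have "r \<in> H j" by (force simp: H_def)
    with r(1) show False by (simp add: H_def)
  qed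
  then have inj: "inj_on H J"
    by (auto intro: inj_onI)
  \<comment> \<open>\<open>facet_of_polyhedron_explicit\<close> indexes facets by halfspaces as
    sets; \<open>inv_into J H\<close> recovers the index, which injectivity of \<open>H\<close>
    makes unique.\<close>
  have facets: "F facet_of P \<longleftrightarrow> (\<exists>h. h \<in> H ` J \<and>
      F = P \<inter> {x. n (inv_into J H h) \<bullet> x = \<beta> (inv_into J H h)})" for F
  proof (rule facet_of_polyhedron_explicit)
    show "finite (H ` J)" using fin by simp
    show "P = affine hull P \<inter> \<Inter>(H ` J)" unfolding hull by (simp add: P_eq)
    show "n (inv_into J H h) \<noteq> 0 \<and> h = {x. n (inv_into J H h) \<bullet> x \<le> \<beta> (inv_into J H h)}"
      if "h \<in> H ` J" for h
      using that inj n_nz by (auto simp: H_def[symmetric])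
  next
    fix F' assume "F' \<subset> H ` J"
    then obtain j where j: "j \<in> J" "H j \<notin> F'" "F' \<subseteq> H ` J" by auto
    from beyond[OF j(1)] obtain r where
      r: "n j \<bullet> r > \<beta> j" "\<And>l. l \<in> J \<Longrightarrow> l \<noteq> j \<Longrightarrow> n l \<bullet> r < \<beta> l" by auto
    have "r \<in> \<Inter>F'"
    proof
      fix h assume "h \<in> F'"
      with j obtain l where "l \<in> J" "l \<noteq> j" "h = H l" by auto
      then show "r \<in> h" using r(2) by (force simp: H_def)
    qed
    moreover have "r \<notin> P" using r(1) j(1) by (force simp: P_def)
    moreover have "P \<subseteq> \<Inter>F'" using j(3) by (auto simp: P_eq)
    ultimately show "P \<subset> affine hull P \<inter> \<Inter>F'" by (auto simp: hull)
  qed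
  have "{F. F facet_of P} = G ` J"
    unfolding facets using inj by (auto simp: G_def)
  moreover have "inj_on G J"
  proof (rule inj_onI)
    fix j l assume jl: "j \<in> J" "l \<in> J" "G j = G l"
    have "q j \<in> G j"
      using facet_pt jl(1) by (force simp: G_def P_def)
    then have "n l \<bullet> q j = \<beta> l"
      using jl(3) by (auto simp: G_def)
    then show "j = l"
      using facet_pt(2)[OF jl(1,2)] by auto
  qed
  ultimately show "card {F. F facet_of P} = card J"
    by (simp add: card_image)
qed

text \<open>Evaluation against \<open>d + 1\<close> vectors with trivial common kernel is an
  injective linear map between spaces of equal dimension, hence onto. Enumerating
  \<open>Basis\<close> by \<open>b\<close> turns it into an endomorphism of
  \<open>'a\<close>.\<close>

lemma dual_family_exists:
  fixes e :: "nat \<Rightarrow> 'a::euclidean_space"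
  assumes dim: "DIM('a) = Suc d" and ker: "\<And>x. (\<And>k. k \<le> d \<Longrightarrow> e k \<bullet> x = 0) \<Longrightarrow> x = 0"
  shows "\<exists>x. \<forall>k\<le>d. e k \<bullet> x = y k"
proof -
  obtain b where b: "bij_betw b {..d} (Basis :: 'a set)"
    using dim by (metis bij_betw_iff_card card_atMost finite_Basis finite_atMost)
  define g where "g x = (\<Sum>k\<le>d. (e k \<bullet> x) *\<^sub>R b k)" for x
  have g_coord: "(\<Sum>k\<le>d. z k *\<^sub>R b k) \<bullet> b j = z j" if "j \<le> d" for z j
  proof -
    have "(\<Sum>k\<le>d. z k *\<^sub>R b k) \<bullet> b j = (\<Sum>k\<le>d. if k = j then z k else 0)"
      unfolding inner_sum_left
    proof (rule sum.cong)
      fix k assume "k \<in> {..d}"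
      with that b have "b k \<bullet> b j = (if k = j then 1 else 0)"
        by (subst inner_Basis) (auto simp: bij_betw_def inj_on_def)
      then show "z k *\<^sub>R b k \<bullet> b j = (if k = j then z k else 0)" by simp
    qed simp
    then show ?thesis using that by simp
  qed
  have lin: "linear g"
    by (auto simp: g_def linear_iff inner_add_right scaleR_add_left sum.distrib scaleR_sum_right)
  moreover have "inj g"
    unfolding linear_injective_0[OF lin]
  proof (intro allI impI)
    fix x assume "g x = 0"
    then have "e k \<bullet> x = 0" if "k \<le> d" for k
      using g_coord[OF that, of "\<lambda>k. e k \<bullet> x"] by (simp add: g_def)
    then show "x = 0" by (rule ker)
  qed
  ultimately have "surj g"
    using linear_injective_imp_surjective by blast
  then obtain x where "g x = (\<Sum>k\<le>d. y k *\<^sub>R b k)" by (metis surjD)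
  then have "e k \<bullet> x = y k" if "k \<le> d" for k
    using g_coord[OF that, of y] g_coord[OF that, of "\<lambda>k. e k \<bullet> x"] by (simp add: g_def)
  then show ?thesis by blast
qed

text \<open>A one-point parametric face is a vertex of the path, even when it occurs as a segment,
  since that segment is then degenerate. So \<open>g\<close> injects \<open>V\<close> into the set
  of visited vertices.\<close>

lemma coherent_path_length_ge:
  assumes "coherent_monotone_path P c vs"
    and "\<And>w. independent {w, c} \<Longrightarrow> w \<noteq> c \<Longrightarrow> \<exists>g. inj_on g V \<and> (\<forall>A\<in>V. {g A} \<in> parametric_faces P c w)"
  shows "card V - 1 \<le> path_length vs"
proof -
  from assms(1) obtain w where w: "w \<noteq> c" "independent {w, c}"
    and faces: "parametric_faces P c w = (\<lambda>v. {v}) ` set vs \<union> path_edges vs"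
    unfolding coherent_monotone_path_def by blast
  from assms(2)[OF w(2,1)] obtain g where
    g: "inj_on g V" "\<And>A. A \<in> V \<Longrightarrow> {g A} \<in> parametric_faces P c w" by auto
  have "g A \<in> set vs" if "A \<in> V" for A
  proof -
    have "{g A} \<in> (\<lambda>v. {v}) ` set vs \<union> path_edges vs"
      using g(2)[OF that] by (simp add: faces)
    then consider "g A \<in> set vs"
      | i where "Suc i < length vs" "{g A} = closed_segment (vs ! i) (vs ! Suc i)"
      by (auto simp: path_edges_def)
    then show ?thesis
    proof cases
      case (2 i)
      then have "vs ! i = g A" by (metis ends_in_segment(1) singletonD)
      then show ?thesis using 2(1) by (metis Suc_lessD nth_mem)
    qed
  qed
  then have "card V \<le> card (set vs)"
    by (intro card_inj_on_le[OF g(1)]) auto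
  also have "\<dots> \<le> length vs" by (rule card_length)
  finally show ?thesis by (simp add: path_length_def)
qed

text \<open>Because the weights are positive, a maximizer must attain each single bound
  \<open>a k \<bullet> v\<close>; the trivial common kernel then leaves only
  \<open>v\<close>.\<close>

lemma maximizers_eq_singleton:
  fixes a :: "nat \<Rightarrow> 'a::euclidean_space"
  assumes v: "v \<in> P" and le: "\<And>k x. k \<le> d \<Longrightarrow> x \<in> P \<Longrightarrow> a k \<bullet> x \<le> a k \<bullet> v"
    and pos: "\<And>k. k \<le> d \<Longrightarrow> \<alpha> k > 0"
    and ker: "\<And>x. (\<And>k. k \<le> d \<Longrightarrow> a k \<bullet> x = 0) \<Longrightarrow> x = 0"
  shows "maximizers P (\<Sum>k\<le>d. \<alpha> k *\<^sub>R a k) = {v}"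
proof -
  let ?n = "\<Sum>k\<le>d. \<alpha> k *\<^sub>R a k"
  have max: "?n \<bullet> x \<le> ?n \<bullet> v" if "x \<in> P" for x
    using le[OF _ that]
    by (auto simp: inner_sum_left intro!: sum_mono mult_left_mono less_imp_le[OF pos])
  have "x = v" if "x \<in> P" "?n \<bullet> x = ?n \<bullet> v" for x
  proof -
    have "(\<Sum>k\<le>d. \<alpha> k * (a k \<bullet> v - a k \<bullet> x)) = 0"
      using that(2) by (simp add: inner_sum_left right_diff_distrib sum_subtractf)
    then have "\<forall>k\<in>{..d}. \<alpha> k * (a k \<bullet> v - a k \<bullet> x) = 0"
      using le[OF _ that(1)]
      by (subst (asm) sum_nonneg_eq_0_iff) (auto intro!: mult_nonneg_nonneg less_imp_le[OF pos])
    then have "a k \<bullet> (v - x) = 0" if "k \<le> d" for k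
      using pos[OF that] that by (force simp: inner_diff_right)
    then show ?thesis
      using ker[of "v - x"] by simp
  qed
  then show ?thesis
    using v max by (fastforce simp: maximizers_def is_arg_max_linorder)
qed

section \<open>Towers\<close>

text \<open>The index \<open>(k, s)\<close> stands for the inequality \<open>s y\<^sub>k + 2 y\<^sub>k\<^sub>-\<^sub>1 \<le> 5\<^sup>k\<close> in the coordinates
  \<open>y\<^sub>k = e k \<bullet> x\<close>, without the second summand if \<open>k = 0\<close>.\<close>

definition facet_index :: "nat \<Rightarrow> (nat \<times> real) set" where
  "facet_index d = insert (0, 1) ({1..d} \<times> {1, -1})"

text \<open>Stated over any real vector space, so that vectors \<open>e k\<close> yield the normals
  and real coordinates yield the left-hand sides of the inequalities.\<close>

definition tower_normal :: "(nat \<Rightarrow> 'a::real_vector) \<Rightarrow> nat \<times> real \<Rightarrow> 'a" where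
  "tower_normal e f = snd f *\<^sub>R e (fst f) + (if fst f = 0 then 0 else 2 *\<^sub>R e (fst f - 1))"

text \<open>Changing the frame by multiples of \<open>e d\<close> changes a direction only by a
  multiple of the objective, which the free parameter of the parametric faces absorbs. A large
  \<open>t\<close> tilts all normals towards the objective.\<close>

definition shear :: "nat \<Rightarrow> real \<Rightarrow> (nat \<Rightarrow> 'a::real_vector) \<Rightarrow> nat \<Rightarrow> 'a" where
  "shear d t e k = (if k < d then e k + t *\<^sub>R e d else e k)"

lemma finite_facet_index [simp]: "finite (facet_index d)"
  by (simp add: facet_index_def)

lemma card_facet_index: "card (facet_index d) = 2 * d + 1"
  by (auto simp: facet_index_def card_insert_if card_cartesian_product)

lemma facet_index_mem: "k \<le> d \<Longrightarrow> s 0 = 1 \<Longrightarrow> s k \<in> {1, -1} \<Longrightarrow> (k, s k) \<in> facet_index d"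
  by (cases "k = 0") (auto simp: facet_index_def)

lemma facet_index_cases:
  assumes "f \<in> facet_index d"
  obtains "f = (0, 1)" | k s where "f = (Suc k, s)" "Suc k \<le> d" "s = 1 \<or> s = -1"
  using assms by (auto simp: facet_index_def) (metis Suc_le_D)+

lemma inner_tower_normal: "tower_normal e f \<bullet> x = tower_normal (\<lambda>k. e k \<bullet> x) f"
  by (simp add: tower_normal_def inner_add_left)

lemma tower_normal_shear:
  "tower_normal (shear d t e) f = tower_normal e f +
     (t * ((if fst f < d then snd f else 0) + (if fst f = 0 then 0 else 2 * of_bool (fst f \<le> d)))) *\<^sub>R e d"
  by (auto simp: tower_normal_def shear_def algebra_simps)

text \<open>With \<open>f = (k, s)\<close>, the value is 1 for \<open>k = 0\<close>,
  \<open>s + 2\<close> for \<open>0 < k < d\<close> and 2 for \<open>k = d\<close>: the factor 2 in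
  the tower inequalities outweighs the sign.\<close>

lemma shear_coefficient_pos:
  assumes "d \<ge> 1" "f \<in> facet_index d"
  shows "(if fst f < d then snd f else 0) + (if fst f = 0 then 0 else 2 * of_bool (fst f \<le> d)) > (0::real)"
  using assms(2) by (rule facet_index_cases) (use assms(1) in auto)

lemma tower_normal_kernel:
  fixes e :: "nat \<Rightarrow> real"
  assumes "\<And>k. k \<le> d \<Longrightarrow> tower_normal e (k, s k) = 0" "\<And>k. s k \<noteq> 0" "k \<le> d"
  shows "e k = 0"
  using assms(3)
proof (induction k)
  case 0
  with assms(1)[of 0] assms(2)[of 0] show ?case by (simp add: tower_normal_def)
next
  case (Suc k)
  with assms(1)[of "Suc k"] assms(2)[of "Suc k"] show ?case by (simp add: tower_normal_def)
qed

text \<open>Comparing coefficients of \<open>e k\<close> gives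
  \<open>s k * \<alpha> k + 2 * \<alpha> (Suc k) = \<omega> k\<close>, which inverts the tent map
  along the branch chosen by \<open>s\<close>. If \<open>0 < \<alpha> k < \<omega> k\<close>, then
  \<open>0 < \<alpha> (Suc k) < \<omega> k\<close> for either sign, and monotonicity of
  \<open>\<omega>\<close> restores the invariant.\<close>

lemma tower_decomposition:
  fixes e :: "nat \<Rightarrow> 'a::real_vector" and \<omega> s :: "nat \<Rightarrow> real"
  assumes "d \<ge> 1" "\<omega> 0 > 0" and mono: "\<And>k. Suc k < d \<Longrightarrow> \<omega> k \<le> \<omega> (Suc k)"
    and s: "s 0 = 1" "\<And>k. s k \<in> {1, -1}"
  shows "\<exists>\<alpha>. (\<forall>k\<le>d. \<alpha> k > 0) \<and>
    (\<Sum>k\<le>d. \<alpha> k *\<^sub>R tower_normal e (k, s k)) = (\<Sum>k<d. \<omega> k *\<^sub>R e k) + (s d * \<alpha> d) *\<^sub>R e d"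
proof -
  \<comment> \<open>The value \<open>\<alpha> 0\<close> is the one free choice; half of
    \<open>\<omega> 0\<close> starts the invariant.\<close>
  define \<alpha> where "\<alpha> = rec_nat (\<omega> 0 / 2) (\<lambda>k a. (\<omega> k - s k * a) / 2)"
  have \<alpha>_0: "\<alpha> 0 = \<omega> 0 / 2" and \<alpha>_Suc: "\<alpha> (Suc k) = (\<omega> k - s k * \<alpha> k) / 2" for k
    by (simp_all add: \<alpha>_def)
  have next_pos: "0 < \<alpha> (Suc k) \<and> \<alpha> (Suc k) < \<omega> k" if "0 < \<alpha> k" "\<alpha> k < \<omega> k" for k
    using s(2)[of k] that by (auto simp: \<alpha>_Suc)
  have lt: "k < d \<Longrightarrow> 0 < \<alpha> k \<and> \<alpha> k < \<omega> k" for k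
  proof (induction k)
    case 0
    then show ?case using assms(2) by (simp add: \<alpha>_0)
  next
    case (Suc k)
    with next_pos[of k] mono[of k] show ?case by auto
  qed
  have "0 < \<alpha> k" if "k \<le> d" for k
  proof (cases k)
    case 0
    then show ?thesis using assms(2) by (simp add: \<alpha>_0)
  next
    case (Suc m)
    then show ?thesis using next_pos[of m] lt[of m] that by auto
  qed
  moreover have "(\<Sum>k\<le>m. \<alpha> k *\<^sub>R tower_normal e (k, s k)) =
      (\<Sum>k<m. \<omega> k *\<^sub>R e k) + (s m * \<alpha> m) *\<^sub>R e m" for m
  proof (induction m)
    case 0
    then show ?case using s(1) by (simp add: tower_normal_def)
  next
    case (Suc m)
    have "2 * \<alpha> (Suc m) + s m * \<alpha> m = \<omega> m"
      by (simp add: \<alpha>_Suc field_simps)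
    then have "(s m * \<alpha> m) *\<^sub>R e m + (2 * \<alpha> (Suc m)) *\<^sub>R e m = \<omega> m *\<^sub>R e m"
      by (metis add.commute scaleR_add_left)
    with Suc.IH show ?case
      by (simp add: tower_normal_def scaleR_add_right mult.commute)
  qed
  ultimately show ?thesis by blast
qed

text \<open>Solves the triangular system in which the inequalities \<open>(k, s k)\<close> are all
  tight, using that a sign is its own inverse; index 0 has only the inequality with sign 1.\<close>

primrec tower_vertex :: "(nat \<Rightarrow> real) \<Rightarrow> nat \<Rightarrow> real" where
  "tower_vertex s 0 = 1"
| "tower_vertex s (Suc k) = s (Suc k) * (5 ^ Suc k - 2 * tower_vertex s k)"

text \<open>The constant 9/5 reproduces itself, as 1 + 2 * (9/5) / 5 = 43/25 is below 45/25. Being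
  smaller than 5/2, it keeps opposite facets apart at every vertex.\<close>

lemma tower_vertex_bound:
  assumes "\<And>k. s k \<in> {1, -1}"
  shows "5 * \<bar>tower_vertex s k\<bar> \<le> 9 * 5 ^ k"
proof (induction k)
  case 0
  then show ?case by simp
next
  case (Suc k)
  then show ?case using assms[of "Suc k"] by auto
qed

lemma tower_vertex_gap:
  assumes "\<And>k. s k \<in> {1, -1}"
  shows "0 < 5 ^ Suc k - 2 * tower_vertex s k"
proof -
  have "(0::real) < 5 ^ k" by simp
  moreover have "tower_vertex s k \<le> \<bar>tower_vertex s k\<bar>" by simp
  ultimately show ?thesis
    using tower_vertex_bound[of s k, OF assms] unfolding power_Suc by linarith
qed

lemma tower_vertex_feasible:
  assumes "\<And>k. s k \<in> {1, -1}" "f \<in> facet_index d"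
  shows "tower_normal (tower_vertex s) f \<le> 5 ^ fst f"
  using assms(2)
proof (rule facet_index_cases)
  fix k t assume "f = (Suc k, t)" "t = 1 \<or> t = - (1::real)"
  with assms(1)[of "Suc k"] tower_vertex_gap[of s k, OF assms(1)] show ?thesis
    by (auto simp: tower_normal_def)
qed (simp add: tower_normal_def)

lemma tower_vertex_tight:
  assumes "s 0 = 1" "\<And>k. s k \<in> {1, -1}"
  shows "tower_normal (tower_vertex s) (k, s k) = 5 ^ k"
proof (cases k)
  case (Suc m)
  then show ?thesis using assms(2)[of k] by (auto simp: tower_normal_def)
qed (simp add: tower_normal_def assms)

text \<open>A point on the facet \<open>f\<close> and on no other: besides \<open>f\<close>, its
  nonzero coordinate enters the opposite inequality with negative sign and the next level as at most
  \<open>2 * 5 ^ k\<close>, below \<open>5 ^ Suc k\<close>.\<close>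

definition facet_centre :: "nat \<times> real \<Rightarrow> nat \<Rightarrow> real" where
  "facet_centre f k = (if k = fst f then snd f * 5 ^ k else 0)"

lemma facet_centre_tight:
  "f \<in> facet_index d \<Longrightarrow> tower_normal (facet_centre f) f = 5 ^ fst f"
  by (erule facet_index_cases) (auto simp: tower_normal_def facet_centre_def)

lemma facet_centre_strict:
  assumes "f \<in> facet_index d" "g \<in> facet_index d" "g \<noteq> f"
  shows "tower_normal (facet_centre f) g < 5 ^ fst g"
  using assms(2)
proof (rule facet_index_cases)
  assume "g = (0, 1)"
  with assms(1,3) show ?thesis
    by (auto simp: tower_normal_def facet_centre_def facet_index_def)
next
  fix k t assume "g = (Suc k, t)" "t = 1 \<or> t = - (1::real)"
  with assms(1,3) show ?thesis
    by (cases "fst f = Suc k"; cases "fst f = k")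
      (auto simp: tower_normal_def facet_centre_def facet_index_def)
qed

text \<open>This direction raises the objective and yet points strictly into the cone of homogenized
  tower inequalities, since \<open>s * y - 2 < 0\<close> whenever \<open>s\<close> and
  \<open>y\<close> are signs.\<close>

lemma tower_normal_inward:
  assumes "d \<ge> 1" "f \<in> facet_index d"
  shows "tower_normal (\<lambda>k. if k < d then -1 else 1 :: real) f < 0"
  using assms(2) by (rule facet_index_cases) (use assms(1) in \<open>auto simp: tower_normal_def\<close>)

lemma tower_normal_cong:
  assumes "\<And>k. k \<le> d \<Longrightarrow> e k = e' k" "f \<in> facet_index d"
  shows "tower_normal e f = tower_normal e' f"
  using assms(2) by (rule facet_index_cases) (auto simp: tower_normal_def assms(1))

section \<open>Combining the towers\<close>

lemma eventually_linear_neg: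
  fixes x y :: real
  assumes "y < 0"
  shows "\<forall>\<^sub>F t in at_top. x + t * y < 0"
  using eventually_gt_at_top[of "x / - y"]
  by eventually_elim (use assms in \<open>simp add: field_simps\<close>)

text \<open>The points are placed one after another at increasing height. A new point is chosen inside all
  earlier cones, slightly beyond the last one; a large shear of its own cone then swallows all
  earlier points, since they lie strictly below it.\<close>

lemma nested_placement:
  fixes b :: "'i \<Rightarrow> 'f \<Rightarrow> 'a::real_inner" and c :: 'a and \<kappa> :: "'f \<Rightarrow> real"
    and a :: "'i \<Rightarrow> real \<Rightarrow> 'f \<Rightarrow> 'a"
  assumes "finite I" "finite F" and \<kappa>: "\<And>f. f \<in> F \<Longrightarrow> \<kappa> f > 0"
    and a: "\<And>i t f. a i t f = b i f + (t * \<kappa> f) *\<^sub>R c"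
    and inward: "\<And>i t. \<exists>r. c \<bullet> r > 0 \<and> (\<forall>f\<in>F. a i t f \<bullet> r < 0)"
  shows "\<exists>p t. (\<forall>i\<in>I. t i \<ge> L) \<and>
    (\<forall>i\<in>I. \<forall>j\<in>I. i \<noteq> j \<longrightarrow> (\<forall>f\<in>F. a i (t i) f \<bullet> (p j - p i) < 0))"
proof -
  \<comment> \<open>The induction also carries \<open>q\<close>, the place for the next point:
    strictly above all points so far and inside all their cones.\<close>
  have "\<exists>p t q. (\<forall>i\<in>I. t i \<ge> L) \<and>
    (\<forall>i\<in>I. \<forall>j\<in>I. i \<noteq> j \<longrightarrow> (\<forall>f\<in>F. a i (t i) f \<bullet> (p j - p i) < 0)) \<and>
    (\<forall>i\<in>I. c \<bullet> (p i - q) < 0 \<and> (\<forall>f\<in>F. a i (t i) f \<bullet> (q - p i) < 0))"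
    using \<open>finite I\<close>
  proof (induction I)
    case empty
    then show ?case by simp
  next
    case (insert i I)
    then obtain p t q where IH_L: "\<forall>j\<in>I. t j \<ge> L"
      and IH_sep: "\<forall>j\<in>I. \<forall>k\<in>I. j \<noteq> k \<longrightarrow> (\<forall>f\<in>F. a j (t j) f \<bullet> (p k - p j) < 0)"
      and IH_q: "\<forall>j\<in>I. c \<bullet> (p j - q) < 0 \<and> (\<forall>f\<in>F. a j (t j) f \<bullet> (q - p j) < 0)"
      by (elim exE conjE)
    have "\<forall>\<^sub>F u in at_top. \<forall>j\<in>I. \<forall>f\<in>F. b i f \<bullet> (p j - q) + u * (\<kappa> f * (c \<bullet> (p j - q))) < 0"
      using \<open>finite I\<close> \<open>finite F\<close>
      by (intro eventually_ball_finite ballI eventually_linear_neg)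
        (use IH_q in \<open>auto intro: mult_pos_neg \<kappa>\<close>)
    then have "\<forall>\<^sub>F u in at_top. L \<le> u \<and> (\<forall>j\<in>I. \<forall>f\<in>F. a i u f \<bullet> (p j - q) < 0)"
      using eventually_ge_at_top[of L]
      by eventually_elim (auto simp: a inner_add_left mult.assoc)
    then obtain u where u: "L \<le> u" "\<And>j f. j \<in> I \<Longrightarrow> f \<in> F \<Longrightarrow> a i u f \<bullet> (p j - q) < 0"
      using eventually_happens'[OF trivial_limit_at_top_linorder] by blast
    obtain r where r: "c \<bullet> r > 0" "\<And>f. f \<in> F \<Longrightarrow> a i u f \<bullet> r < 0"
      using inward by blast
    \<comment> \<open>A short step from \<open>q\<close> along \<open>r\<close> stays in the old
      cones, enters the new cone at \<open>q\<close> and gains height, so it serves as the next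
      \<open>q\<close>.\<close>
    have "\<forall>\<^sub>F \<delta> in at_right 0. \<forall>j\<in>I. \<forall>f\<in>F. a j (t j) f \<bullet> (q - p j) + \<delta> * (a j (t j) f \<bullet> r) < 0"
      using \<open>finite I\<close> \<open>finite F\<close>
      by (intro eventually_ball_finite ballI eventually_affine_less) (simp_all add: IH_q)
    moreover have "\<forall>\<^sub>F \<delta> in at_right (0::real). 0 < \<delta>"
      by (simp add: eventually_at_right_less)
    ultimately have "\<forall>\<^sub>F \<delta> in at_right 0. 0 < \<delta> \<and>
        (\<forall>j\<in>I. \<forall>f\<in>F. a j (t j) f \<bullet> (q - p j) + \<delta> * (a j (t j) f \<bullet> r) < 0)"
      by eventually_elim auto
    then obtain \<delta> :: real where \<delta>: "\<delta> > 0"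
      "\<And>j f. j \<in> I \<Longrightarrow> f \<in> F \<Longrightarrow> a j (t j) f \<bullet> (q - p j) + \<delta> * (a j (t j) f \<bullet> r) < 0"
      using eventually_happens'[OF trivial_limit_at_right_real] by blast
    have new: "c \<bullet> (p j - (q + \<delta> *\<^sub>R r)) < 0" "f \<in> F \<Longrightarrow> a j (t j) f \<bullet> (q + \<delta> *\<^sub>R r - p j) < 0"
      if "j \<in> I" for j f
    proof -
      have "c \<bullet> (p j - q) < 0" using IH_q that by blast
      moreover have "0 < \<delta> * (c \<bullet> r)" using \<delta>(1) r(1) by simp
      ultimately show "c \<bullet> (p j - (q + \<delta> *\<^sub>R r)) < 0"
        by (simp add: inner_diff_right inner_add_right)
      show "a j (t j) f \<bullet> (q + \<delta> *\<^sub>R r - p j) < 0" if "f \<in> F"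
        using \<delta>(2)[OF \<open>j \<in> I\<close> that] by (simp add: inner_diff_right inner_add_right)
    qed
    have "i \<notin> I" by fact
    then have ne: "j \<noteq> i" if "j \<in> I" for j using that by blast
    show ?case
    proof (intro exI conjI ballI impI)
      show "(t(i := u)) j \<ge> L" if "j \<in> insert i I" for j
        using that IH_L u(1) by auto
      show "a j ((t(i := u)) j) f \<bullet> ((p(i := q)) k - (p(i := q)) j) < 0"
        if "j \<in> insert i I" "k \<in> insert i I" "j \<noteq> k" "f \<in> F" for j k f
        using that IH_sep IH_q u(2)[of k f] ne by auto
      show "c \<bullet> ((p(i := q)) j - (q + \<delta> *\<^sub>R r)) < 0" if "j \<in> insert i I" for j
        using that new(1)[of j] \<delta>(1) r(1) by (cases "j = i") auto
      show "a j ((t(i := u)) j) f \<bullet> (q + \<delta> *\<^sub>R r - (p(i := q)) j) < 0"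
        if "j \<in> insert i I" "f \<in> F" for j f
        using that new(2)[of j f] \<delta>(1) r(2)[of f] by (cases "j = i") (auto simp: mult_less_0_iff)
    qed
  qed
  then show ?thesis by blast
qed

text \<open>Around \<open>p i\<close> the polytope is a small copy of the \<open>i\<close>-th tower.
  By \<open>cover\<close>, each direction modulo \<open>c\<close> suits some \<open>i\<close>, and
  then each vertex of that copy is a parametric face. Subsets of \<open>{1..d}\<close> record where
  the sign is negative.\<close>

lemma tower_polytope_exists:
  fixes e :: "'i::finite \<Rightarrow> nat \<Rightarrow> 'a::euclidean_space" and c :: 'a
  assumes dim: "DIM('a) = Suc d" and d: "d \<ge> 1" and e_d: "\<And>i. e i d = c"
    and ker: "\<And>i x. (\<And>k. k \<le> d \<Longrightarrow> e i k \<bullet> x = 0) \<Longrightarrow> x = 0"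
    and cover: "\<And>w. w \<notin> span {c} \<Longrightarrow> \<exists>i \<omega> \<tau>. w = (\<Sum>k<d. \<omega> k *\<^sub>R e i k) + \<tau> *\<^sub>R c \<and>
      0 < \<omega> 0 \<and> (\<forall>k. Suc k < d \<longrightarrow> \<omega> k \<le> \<omega> (Suc k))"
  shows "\<exists>P. polytope P \<and> aff_dim P = DIM('a) \<and>
    card {F. F facet_of P} = CARD('i) * (2 * d + 1) + 1 \<and>
    (\<forall>w. w \<notin> span {c} \<longrightarrow>
      (\<exists>g. inj_on g (Pow {1..d}) \<and> (\<forall>A\<in>Pow {1..d}. {g A} \<in> parametric_faces P c w)))"
proof -

  \<comment> \<open>Sheared frames and their normals\<close>
  let ?F = "facet_index d"
  define \<kappa> :: "nat \<times> real \<Rightarrow> real" where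
    "\<kappa> f = (if fst f < d then snd f else 0) + (if fst f = 0 then 0 else 2 * of_bool (fst f \<le> d))" for f
  define a where "a i t = tower_normal (shear d t (e i))" for i t
  have a_eq: "a i t f = tower_normal (e i) f + (t * \<kappa> f) *\<^sub>R c" for i t f
    by (simp add: a_def \<kappa>_def tower_normal_shear e_d)
  have \<kappa>_pos: "\<kappa> f > 0" if "f \<in> ?F" for f
    unfolding \<kappa>_def using shear_coefficient_pos[OF d that] .
  have shear_ker: "x = 0" if "\<And>k. k \<le> d \<Longrightarrow> shear d t (e i) k \<bullet> x = 0" for i t x
  proof (rule ker[of i])
    fix k assume "k \<le> d"
    with that[of k] that[of d] show "e i k \<bullet> x = 0"
      by (auto simp: shear_def inner_add_left split: if_splits)
  qed
  have dual: "\<exists>x. \<forall>k\<le>d. shear d t (e i) k \<bullet> x = y k" for i t y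
    using dual_family_exists[OF dim] shear_ker by blast
  have shear_d: "shear d t (e i) d = c" for i t
    by (simp add: shear_def e_d)
  have shear_sum: "(\<Sum>k<d. \<omega> k *\<^sub>R shear d t (e i) k) =
      (\<Sum>k<d. \<omega> k *\<^sub>R e i k) + (t * (\<Sum>k<d. \<omega> k)) *\<^sub>R c" for \<omega> t i
  proof -
    have "(\<Sum>k<d. \<omega> k *\<^sub>R shear d t (e i) k) = (\<Sum>k<d. \<omega> k *\<^sub>R e i k + (t * \<omega> k) *\<^sub>R c)"
      by (intro sum.cong) (auto simp: shear_def e_d scaleR_add_right mult.commute)
    then show ?thesis
      by (simp add: sum.distrib scaleR_sum_left sum_distrib_left)
  qed

  \<comment> \<open>Positive combinations of normals for every sign pattern\<close>
  define signs where "signs A k = (if k \<in> A then -1 else 1 :: real)" for A :: "nat set" and k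
  have signs: "signs A k \<in> {1, -1}" for A k by (simp add: signs_def)
  have signs_0: "signs A 0 = 1" if "A \<subseteq> {1..d}" for A using that by (auto simp: signs_def)

  \<comment> \<open>The tower \<open>i\<close> and the coefficients \<open>\<omega>\<close> serve
    all shears \<open>t\<close> and all patterns \<open>A\<close> at once; only the multiple of
    \<open>c\<close> added to \<open>w\<close> depends on them.\<close>
  have decomp: "\<exists>i \<omega> \<tau>. 0 < sum \<omega> {..<d} \<and> (\<forall>t. \<forall>A\<subseteq>{1..d}. \<exists>\<alpha>. (\<forall>k\<le>d. \<alpha> k > 0) \<and>
      w + (t * sum \<omega> {..<d} - \<tau> + signs A d * \<alpha> d) *\<^sub>R c = (\<Sum>k\<le>d. \<alpha> k *\<^sub>R a i t (k, signs A k)))"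
    if "w \<notin> span {c}" for w
  proof -
    from cover[OF that] obtain i \<omega> \<tau> where w: "w = (\<Sum>k<d. \<omega> k *\<^sub>R e i k) + \<tau> *\<^sub>R c"
      and \<omega>: "0 < \<omega> 0" "\<And>k. Suc k < d \<Longrightarrow> \<omega> k \<le> \<omega> (Suc k)" by blast
    have "0 < \<omega> k" if "k < d" for k
      using that by (induction k) (use \<omega> in \<open>auto intro: less_le_trans\<close>)
    then have "0 < sum \<omega> {..<d}"
      using d by (intro sum_pos) (auto simp: lessThan_empty_iff)
    moreover have "\<exists>\<alpha>. (\<forall>k\<le>d. \<alpha> k > 0) \<and>
      w + (t * sum \<omega> {..<d} - \<tau> + signs A d * \<alpha> d) *\<^sub>R c = (\<Sum>k\<le>d. \<alpha> k *\<^sub>R a i t (k, signs A k))"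
      if A: "A \<subseteq> {1..d}" for t A
    proof -
      obtain \<alpha> where "\<forall>k\<le>d. \<alpha> k > 0" "(\<Sum>k\<le>d. \<alpha> k *\<^sub>R a i t (k, signs A k)) =
          (\<Sum>k<d. \<omega> k *\<^sub>R shear d t (e i) k) + (signs A d * \<alpha> d) *\<^sub>R c"
        using tower_decomposition[of d \<omega> "signs A" "shear d t (e i)"] d \<omega> signs signs_0[OF A]
        unfolding a_def shear_d by blast
      then show ?thesis
        by (intro exI[of _ \<alpha>]) (simp add: shear_sum w algebra_simps)
    qed
    ultimately show ?thesis by blast
  qed

  \<comment> \<open>A lower bound for the shears\<close>
  obtain w\<^sub>0 where w\<^sub>0: "w\<^sub>0 \<noteq> 0" "c \<bullet> w\<^sub>0 = 0"
  proof -
    obtain x where "\<forall>k\<le>d. shear d 0 (e undefined) k \<bullet> x = (if k = 0 then 1 else 0)"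
      using dual[of 0 undefined "\<lambda>k. if k = 0 then 1 else 0"] by auto
    with d shear_d have "shear d 0 (e undefined) 0 \<bullet> x = 1" "c \<bullet> x = 0" by (fastforce, fastforce)
    moreover from this have "x \<noteq> 0" by (metis inner_zero_right zero_neq_one)
    ultimately show thesis using that[of x] by blast
  qed
  have c_nz: "c \<noteq> 0"
  proof -
    obtain x where "\<forall>k\<le>d. shear d 0 (e undefined) k \<bullet> x = 1"
      using dual[of 0 undefined "\<lambda>_. 1"] by auto
    with shear_d have "c \<bullet> x = 1" by fastforce
    then show ?thesis by auto
  qed
  have orthogonal_notin: "w \<notin> span {c}" if "w \<noteq> 0" "c \<bullet> w = 0" for w
  proof
    assume "w \<in> span {c}"
    then obtain k where "w = k *\<^sub>R c" by (auto simp: span_singleton)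
    with that(2) have "w \<bullet> w = 0" by simp
    with that(1) show False by simp
  qed
  have notin: "w\<^sub>0 \<notin> span {c}" "- w\<^sub>0 \<notin> span {c}"
    using w\<^sub>0 by (intro orthogonal_notin; simp)+
  \<comment> \<open>Opposite directions are decomposed so that adding the two combinations cancels
    \<open>w\<^sub>0\<close> and leaves a multiple of \<open>c\<close>. It is positive for large
    shears, which will bound the objective from above.\<close>
  obtain i\<^sub>1 \<omega>\<^sub>1 \<tau>\<^sub>1 where one: "0 < sum \<omega>\<^sub>1 {..<d}" "\<forall>t. \<forall>A\<subseteq>{1..d}. \<exists>\<alpha>. (\<forall>k\<le>d. \<alpha> k > 0) \<and>
      w\<^sub>0 + (t * sum \<omega>\<^sub>1 {..<d} - \<tau>\<^sub>1 + signs A d * \<alpha> d) *\<^sub>R c = (\<Sum>k\<le>d. \<alpha> k *\<^sub>R a i\<^sub>1 t (k, signs A k))"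
    using decomp[OF notin(1)] by blast
  obtain i\<^sub>2 \<omega>\<^sub>2 \<tau>\<^sub>2 where two: "0 < sum \<omega>\<^sub>2 {..<d}" "\<forall>t. \<forall>A\<subseteq>{1..d}. \<exists>\<alpha>. (\<forall>k\<le>d. \<alpha> k > 0) \<and>
      - w\<^sub>0 + (t * sum \<omega>\<^sub>2 {..<d} - \<tau>\<^sub>2 + signs A d * \<alpha> d) *\<^sub>R c = (\<Sum>k\<le>d. \<alpha> k *\<^sub>R a i\<^sub>2 t (k, signs A k))"
    using decomp[OF notin(2)] by blast
  have "\<forall>\<^sub>F t in at_top. (\<forall>i\<in>UNIV. \<forall>f\<in>?F. - (tower_normal (e i) f \<bullet> c) + t * - (\<kappa> f * (c \<bullet> c)) < 0) \<and>
      \<tau>\<^sub>1 + t * - sum \<omega>\<^sub>1 {..<d} < 0 \<and> \<tau>\<^sub>2 + t * - sum \<omega>\<^sub>2 {..<d} < 0"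
    using one(1) two(1) c_nz
    by (intro eventually_conj eventually_ball_finite ballI eventually_linear_neg) (auto simp: \<kappa>_pos)
  then obtain L where L': "\<forall>t\<ge>L. (\<forall>i\<in>UNIV. \<forall>f\<in>?F. - (tower_normal (e i) f \<bullet> c) + t * - (\<kappa> f * (c \<bullet> c)) < 0) \<and>
      \<tau>\<^sub>1 + t * - sum \<omega>\<^sub>1 {..<d} < 0 \<and> \<tau>\<^sub>2 + t * - sum \<omega>\<^sub>2 {..<d} < 0"
    unfolding eventually_at_top_linorder by blast
  have L: "f \<in> ?F \<Longrightarrow> a i t f \<bullet> c > 0" "t * sum \<omega>\<^sub>1 {..<d} - \<tau>\<^sub>1 > 0" "t * sum \<omega>\<^sub>2 {..<d} - \<tau>\<^sub>2 > 0"
    if "t \<ge> L" for i t f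
  proof -
    from L' that have *: "\<forall>i\<in>UNIV. \<forall>f\<in>?F. - (tower_normal (e i) f \<bullet> c) + t * - (\<kappa> f * (c \<bullet> c)) < 0"
      "\<tau>\<^sub>1 + t * - sum \<omega>\<^sub>1 {..<d} < 0" "\<tau>\<^sub>2 + t * - sum \<omega>\<^sub>2 {..<d} < 0" by blast+
    show "a i t f \<bullet> c > 0" if "f \<in> ?F"
      using *(1)[rule_format, of i f] that by (simp add: a_eq inner_add_left mult.assoc)
    from *(2,3) show "t * sum \<omega>\<^sub>1 {..<d} - \<tau>\<^sub>1 > 0" "t * sum \<omega>\<^sub>2 {..<d} - \<tau>\<^sub>2 > 0" by auto
  qed

  \<comment> \<open>Placing the towers\<close>
  have inward: "\<exists>r. c \<bullet> r > 0 \<and> (\<forall>f\<in>?F. a i t f \<bullet> r < 0)" for i t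
  proof -
    let ?y = "\<lambda>k. if k < d then -1 else 1 :: real"
    obtain r where r: "\<And>k. k \<le> d \<Longrightarrow> shear d t (e i) k \<bullet> r = ?y k"
      using dual[of t i ?y] by blast
    have "a i t f \<bullet> r = tower_normal ?y f" if "f \<in> ?F" for f
      unfolding a_def inner_tower_normal by (rule tower_normal_cong[OF _ that]) (rule r)
    moreover have "c \<bullet> r = 1" using r[of d] by (simp add: shear_d)
    ultimately show ?thesis using tower_normal_inward[OF d] by (metis zero_less_one)
  qed
  have "\<exists>p t. (\<forall>i\<in>UNIV. t i \<ge> L) \<and>
      (\<forall>i\<in>UNIV. \<forall>j\<in>UNIV. i \<noteq> j \<longrightarrow> (\<forall>f\<in>?F. a i (t i) f \<bullet> (p j - p i) < 0))"
    by (rule nested_placement[OF finite finite_facet_index \<kappa>_pos a_eq inward])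
  then obtain p t where placed: "\<forall>i\<in>UNIV. t i \<ge> L"
    "\<forall>i\<in>UNIV. \<forall>j\<in>UNIV. i \<noteq> j \<longrightarrow> (\<forall>f\<in>?F. a i (t i) f \<bullet> (p j - p i) < 0)"
    by (elim exE conjE)
  have t: "t i \<ge> L" and sep: "i \<noteq> j \<Longrightarrow> f \<in> ?F \<Longrightarrow> a i (t i) f \<bullet> (p j - p i) < 0" for i j f
    using placed by blast+
  define n where "n i = a i (t i)" for i
  have n_c: "n i f \<bullet> c > 0" if "f \<in> ?F" for i f
    using L(1)[OF t that] by (simp add: n_def)
  have n_ker: "x = 0" if "\<And>k. k \<le> d \<Longrightarrow> n i (k, signs A k) \<bullet> x = 0" for i A x
  proof (rule shear_ker)
    fix k assume "k \<le> d"
    show "shear d (t i) (e i) k \<bullet> x = 0"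
    proof (rule tower_normal_kernel[of d _ "signs A", OF _ _ \<open>k \<le> d\<close>])
      fix k assume "k \<le> d"
      then show "tower_normal (\<lambda>k. shear d (t i) (e i) k \<bullet> x) (k, signs A k) = 0"
        using that[of k] by (simp add: n_def a_def inner_tower_normal)
    qed (simp add: signs_def)
  qed
  obtain X where X: "\<And>i y k. k \<le> d \<Longrightarrow> shear d (t i) (e i) k \<bullet> X i y = y k"
  proof -
    have "\<forall>i y. \<exists>x. \<forall>k\<le>d. shear d (t i) (e i) k \<bullet> x = y k" using dual by blast
    then show thesis using that by metis
  qed
  have n_X: "n i f \<bullet> X i y = tower_normal y f" if "f \<in> ?F" for i y f
    unfolding n_def a_def inner_tower_normal
    by (rule tower_normal_cong[OF _ that]) (rule X)
  obtain z where z: "\<And>i. z < c \<bullet> p i"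
  proof -
    have "Min (range (\<lambda>i. c \<bullet> p i)) \<le> c \<bullet> p i" for i
      by (rule Min_le) auto
    then have "Min (range (\<lambda>i. c \<bullet> p i)) - 1 < c \<bullet> p i" for i
      by (smt (verit))
    then show thesis using that by blast
  qed

  \<comment> \<open>A common scale for the towers\<close>
  define Y where "Y = (\<lambda>A. tower_vertex (signs A)) ` Pow {1..d} \<union> facet_centre ` ?F"
  have finite_Y: "finite Y" by (simp add: Y_def)
  obtain \<epsilon> :: real where \<epsilon>: "\<epsilon> > 0"
    "\<And>i j f y. i \<noteq> j \<Longrightarrow> f \<in> ?F \<Longrightarrow> y \<in> Y \<Longrightarrow>
      n j f \<bullet> (p i - p j) + \<epsilon> * (n j f \<bullet> X i y - 5 ^ fst f) < 0"
    "\<And>i y. y \<in> Y \<Longrightarrow> - (c \<bullet> p i) + \<epsilon> * - (c \<bullet> X i y) < - z"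
  proof -
    \<comment> \<open>As \<open>\<epsilon>\<close> tends to 0, the finitely many points
      \<open>p i + \<epsilon> *\<^sub>R X i y\<close> tend to \<open>p i\<close>, which lies above
      height \<open>z\<close> and strictly inside the cones at the other points.\<close>
    have "\<forall>\<^sub>F \<epsilon> in at_right 0.
        (\<forall>i\<in>UNIV. \<forall>j\<in>UNIV - {i}. \<forall>f\<in>?F. \<forall>y\<in>Y. n j f \<bullet> (p i - p j) + \<epsilon> * (n j f \<bullet> X i y - 5 ^ fst f) < 0) \<and>
        (\<forall>i\<in>UNIV. \<forall>y\<in>Y. - (c \<bullet> p i) + \<epsilon> * - (c \<bullet> X i y) < - z) \<and> 0 < \<epsilon>"
      using sep z finite_Y
      by (intro eventually_conj eventually_ball_finite ballI eventually_affine_less eventually_at_right_less)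
        (auto simp: n_def)
    from eventually_happens'[OF trivial_limit_at_right_real this] obtain \<epsilon> where *:
      "\<forall>i\<in>UNIV. \<forall>j\<in>UNIV - {i}. \<forall>f\<in>?F. \<forall>y\<in>Y. n j f \<bullet> (p i - p j) + \<epsilon> * (n j f \<bullet> X i y - 5 ^ fst f) < 0"
      "\<forall>i\<in>UNIV. \<forall>y\<in>Y. - (c \<bullet> p i) + \<epsilon> * - (c \<bullet> X i y) < - z" "0 < \<epsilon>"
      by (elim exE conjE)
    show thesis
    proof (rule that)
      show "n j f \<bullet> (p i - p j) + \<epsilon> * (n j f \<bullet> X i y - 5 ^ fst f) < 0"
        if "i \<noteq> j" "f \<in> ?F" "y \<in> Y" for i j f y
        using *(1) that by blast
      show "- (c \<bullet> p i) + \<epsilon> * - (c \<bullet> X i y) < - z" if "y \<in> Y" for i y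
        using *(2) that by blast
    qed (rule *(3))
  qed

  \<comment> \<open>The polytope and its facets\<close>
  define N where "N = case_option (- c) (\<lambda>(i, f). n i f)"
  \<comment> \<open>\<open>None\<close> is the horizontal cut at height \<open>z\<close>; the other
    bounds are the tower inequalities in coordinates centred at \<open>p i\<close> and scaled by
    \<open>\<epsilon>\<close>.\<close>
  define \<beta> where "\<beta> = case_option (- z) (\<lambda>(i, f). n i f \<bullet> p i + \<epsilon> * 5 ^ fst f)"
  have N_simps [simp]: "N None = - c" "N (Some (i, f)) = n i f"
    and \<beta>_simps [simp]: "\<beta> None = - z" "\<beta> (Some (i, f)) = n i f \<bullet> p i + \<epsilon> * 5 ^ fst f" for i f
    by (simp_all add: N_def \<beta>_def)
  define J where "J = insert None (Some ` ((UNIV :: 'i set) \<times> ?F))"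
  define P where "P = {x. \<forall>j\<in>J. N j \<bullet> x \<le> \<beta> j}"
  define pt where "pt i y = p i + \<epsilon> *\<^sub>R X i y" for i y
  have pt_own: "n i f \<bullet> pt i y = n i f \<bullet> p i + \<epsilon> * tower_normal y f" if "f \<in> ?F" for i f y
    using that by (simp add: pt_def inner_add_right n_X)
  have pt_other: "n j f \<bullet> pt i y < \<beta> (Some (j, f))" if "i \<noteq> j" "f \<in> ?F" "y \<in> Y" for i j f y
    using \<epsilon>(2)[OF that] by (simp add: pt_def algebra_simps)
  have pt_bottom: "- (c \<bullet> pt i y) < - z" if "y \<in> Y" for i y
    using \<epsilon>(3)[OF that, of i] by (simp add: pt_def inner_add_right)
  have p_J: "N j \<bullet> p i < \<beta> j" if "j \<in> J" for i j
  proof -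
    from that consider "j = None" | k f where "j = Some (k, f)" "f \<in> ?F" by (auto simp: J_def)
    then show ?thesis
    proof cases
      case (2 k f)
      have "0 < \<epsilon> * 5 ^ fst f" using \<epsilon>(1) by simp
      moreover have "n k f \<bullet> p i \<le> n k f \<bullet> p k"
        using sep[of k i f] 2(2) by (cases "k = i") (auto simp: n_def inner_diff_right)
      ultimately show ?thesis by (simp add: 2(1))
    qed (simp add: z)
  qed

  \<comment> \<open>Some \<open>p i\<close> is moved along \<open>- c\<close> down to height
    \<open>z\<close>. All tower normals have positive inner product with \<open>c\<close>, so their
    inequalities stay strict.\<close>
  define bottom where "bottom = p undefined - ((c \<bullet> p undefined - z) / (c \<bullet> c)) *\<^sub>R c"
  define q where "q = case_option bottom (\<lambda>(i, f). pt i (facet_centre f))"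
  have q_tight: "N j \<bullet> q j = \<beta> j" if "j \<in> J" for j
    using that c_nz by (auto simp: J_def q_def bottom_def inner_diff_right pt_own facet_centre_tight)
  have q_strict: "N l \<bullet> q j < \<beta> l" if "j \<in> J" "l \<in> J" "l \<noteq> j" for j l
  proof (cases j)
    case None
    with that obtain i f where l: "l = Some (i, f)" "f \<in> ?F" by (auto simp: J_def)
    have "0 < (c \<bullet> p undefined - z) / (c \<bullet> c) * (n i f \<bullet> c)"
      using z n_c[OF l(2)] c_nz by (intro mult_pos_pos divide_pos_pos) auto
    with p_J[OF that(2), of undefined] show ?thesis
      by (simp add: None l(1) q_def bottom_def inner_diff_right)
  next
    case (Some r)
    with that obtain i f where j: "j = Some (i, f)" "f \<in> ?F" by (auto simp: J_def)
    then have Y: "facet_centre f \<in> Y" by (simp add: Y_def)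
    from that consider "l = None" | k g where "l = Some (k, g)" "g \<in> ?F" by (auto simp: J_def)
    then show ?thesis
    proof cases
      case 1
      then show ?thesis using pt_bottom[OF Y] by (simp add: j(1) q_def)
    next
      case (2 k g)
      then show ?thesis
        using pt_other[of i k g, OF _ _ Y] facet_centre_strict[OF j(2) 2(2)] that(3) pt_own[OF 2(2)] \<epsilon>(1)
        by (cases "k = i") (auto simp: j(1) q_def)
    qed
  qed

  \<comment> \<open>Boundedness\<close>
  have P_bounds: "n i f \<bullet> x \<le> \<beta> (Some (i, f))" if "x \<in> P" "f \<in> ?F" for x i f
    using that unfolding P_def J_def by (metis (mono_tags, lifting) N_simps(2) SigmaI UNIV_I image_eqI insertCI mem_Collect_eq)
  have P_bottom: "z \<le> c \<bullet> x" if "x \<in> P" for x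
    using that by (auto simp: P_def J_def)
  have comb_bound: "\<exists>C. \<forall>x\<in>P. (\<Sum>k\<le>d. \<alpha> k *\<^sub>R n i (k, signs A k)) \<bullet> x \<le> C"
    if "\<forall>k\<le>d. \<alpha> k > 0" "A \<subseteq> {1..d}" for \<alpha> A i
  proof (intro exI ballI)
    fix x assume "x \<in> P"
    with that show "(\<Sum>k\<le>d. \<alpha> k *\<^sub>R n i (k, signs A k)) \<bullet> x \<le> (\<Sum>k\<le>d. \<alpha> k * \<beta> (Some (i, (k, signs A k))))"
      unfolding inner_sum_left inner_scaleR_left
      by (intro sum_mono mult_left_mono P_bounds facet_index_mem signs_0 signs)
        (auto intro: less_imp_le)
  qed
  have signs_empty: "signs {} d = 1" by (simp add: signs_def)
  obtain C\<^sub>0 where C\<^sub>0: "\<And>x. x \<in> P \<Longrightarrow> c \<bullet> x \<le> C\<^sub>0"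
  proof -
    obtain \<alpha>\<^sub>1 where \<alpha>\<^sub>1: "\<forall>k\<le>d. \<alpha>\<^sub>1 k > 0"
      "w\<^sub>0 + (t i\<^sub>1 * sum \<omega>\<^sub>1 {..<d} - \<tau>\<^sub>1 + \<alpha>\<^sub>1 d) *\<^sub>R c = (\<Sum>k\<le>d. \<alpha>\<^sub>1 k *\<^sub>R n i\<^sub>1 (k, signs {} k))"
      using one(2)[rule_format, of "{}" "t i\<^sub>1"] by (auto simp: signs_empty n_def)
    obtain \<alpha>\<^sub>2 where \<alpha>\<^sub>2: "\<forall>k\<le>d. \<alpha>\<^sub>2 k > 0"
      "- w\<^sub>0 + (t i\<^sub>2 * sum \<omega>\<^sub>2 {..<d} - \<tau>\<^sub>2 + \<alpha>\<^sub>2 d) *\<^sub>R c = (\<Sum>k\<le>d. \<alpha>\<^sub>2 k *\<^sub>R n i\<^sub>2 (k, signs {} k))"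
      using two(2)[rule_format, of "{}" "t i\<^sub>2"] by (auto simp: signs_empty n_def)
    define \<mu>\<^sub>1 \<mu>\<^sub>2 where \<mu>: "\<mu>\<^sub>1 = t i\<^sub>1 * sum \<omega>\<^sub>1 {..<d} - \<tau>\<^sub>1 + \<alpha>\<^sub>1 d" "\<mu>\<^sub>2 = t i\<^sub>2 * sum \<omega>\<^sub>2 {..<d} - \<tau>\<^sub>2 + \<alpha>\<^sub>2 d"
    have pos: "0 < \<mu>\<^sub>1 + \<mu>\<^sub>2"
      using L(2,3)[OF t] \<alpha>\<^sub>1(1) \<alpha>\<^sub>2(1) unfolding \<mu> by (intro add_pos_pos) auto
    obtain C\<^sub>1 C\<^sub>2 where C: "\<And>x. x \<in> P \<Longrightarrow> (w\<^sub>0 + \<mu>\<^sub>1 *\<^sub>R c) \<bullet> x \<le> C\<^sub>1" "\<And>x. x \<in> P \<Longrightarrow> (- w\<^sub>0 + \<mu>\<^sub>2 *\<^sub>R c) \<bullet> x \<le> C\<^sub>2"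
      using comb_bound[OF \<alpha>\<^sub>1(1), of "{}"] comb_bound[OF \<alpha>\<^sub>2(1), of "{}"] \<alpha>\<^sub>1(2) \<alpha>\<^sub>2(2) unfolding \<mu> by (metis empty_subsetI)
    have "(\<mu>\<^sub>1 + \<mu>\<^sub>2) * (c \<bullet> x) \<le> C\<^sub>1 + C\<^sub>2" if "x \<in> P" for x
      using C(1)[OF that] C(2)[OF that] by (simp add: inner_add_left inner_diff_left distrib_right)
    with pos have "c \<bullet> x \<le> (C\<^sub>1 + C\<^sub>2) / (\<mu>\<^sub>1 + \<mu>\<^sub>2)" if "x \<in> P" for x
      using that by (simp add: pos_le_divide_eq mult.commute)
    then show thesis by (rule that)
  qed
  have c_mult_bound: "\<exists>C. \<forall>x\<in>P. \<mu> * (c \<bullet> x) \<le> C" for \<mu>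
  proof (intro exI ballI)
    fix x assume x: "x \<in> P"
    show "\<mu> * (c \<bullet> x) \<le> \<bar>\<mu>\<bar> * (\<bar>C\<^sub>0\<bar> + \<bar>z\<bar>)"
    proof -
      have "\<bar>c \<bullet> x\<bar> \<le> \<bar>C\<^sub>0\<bar> + \<bar>z\<bar>" using C\<^sub>0[OF x] P_bottom[OF x] by linarith
      then have "\<bar>\<mu>\<bar> * \<bar>c \<bullet> x\<bar> \<le> \<bar>\<mu>\<bar> * (\<bar>C\<^sub>0\<bar> + \<bar>z\<bar>)" by (intro mult_left_mono) auto
      then show ?thesis by (metis abs_ge_self abs_mult order_trans)
    qed
  qed
  \<comment> \<open>The pattern \<open>{}\<close> bounds \<open>u + \<mu> *\<^sub>R c\<close> from
    above for some \<open>\<mu>\<close>; the objective is bounded on both sides, so the multiple of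
    \<open>c\<close> can be removed.\<close>
  have "bounded P"
  proof (rule bounded_if_inner_bounded_above)
    fix u
    show "\<exists>C. \<forall>x\<in>P. u \<bullet> x \<le> C"
    proof (cases "u \<in> span {c}")
      case True
      then show ?thesis using c_mult_bound by (auto simp: span_singleton)
    next
      case False
      from decomp[OF this] obtain i \<omega> \<tau> where "\<forall>t. \<forall>A\<subseteq>{1..d}. \<exists>\<alpha>. (\<forall>k\<le>d. \<alpha> k > 0) \<and>
        u + (t * sum \<omega> {..<d} - \<tau> + signs A d * \<alpha> d) *\<^sub>R c = (\<Sum>k\<le>d. \<alpha> k *\<^sub>R a i t (k, signs A k))"
        by blast
      from this[rule_format, of "{}" "t i"] obtain \<alpha> where \<alpha>: "\<forall>k\<le>d. \<alpha> k > 0"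
        "u + (t i * sum \<omega> {..<d} - \<tau> + \<alpha> d) *\<^sub>R c = (\<Sum>k\<le>d. \<alpha> k *\<^sub>R n i (k, signs {} k))"
        by (auto simp: signs_empty n_def)
      define \<mu> where "\<mu> = t i * sum \<omega> {..<d} - \<tau> + \<alpha> d"
      obtain C where C: "\<And>x. x \<in> P \<Longrightarrow> (u + \<mu> *\<^sub>R c) \<bullet> x \<le> C"
        using comb_bound[OF \<alpha>(1), of "{}"] \<alpha>(2) unfolding \<mu>_def by (metis empty_subsetI)
      obtain D where D: "\<And>x. x \<in> P \<Longrightarrow> - \<mu> * (c \<bullet> x) \<le> D"
        using c_mult_bound[of "- \<mu>"] by blast
      have "u \<bullet> x \<le> C + D" if "x \<in> P" for x
        using C[OF that] D[OF that] by (simp add: inner_add_left)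
      then show ?thesis by blast
    qed
  qed
  note polytope = irredundant_halfspaces_polytope[of J N \<beta>, folded P_def, OF _ this p_J q_tight q_strict]
  have card_J: "card J = CARD('i) * (2 * d + 1) + 1"
    unfolding J_def by (subst card_insert_disjoint)
      (auto simp: card_image card_cartesian_product card_facet_index)

  \<comment> \<open>One-point faces in every direction\<close>
  have "\<exists>g. inj_on g (Pow {1..d}) \<and> (\<forall>A\<in>Pow {1..d}. {g A} \<in> parametric_faces P c w)"
    if "w \<notin> span {c}" for w
  proof -
    from decomp[OF that] obtain i \<omega> \<tau> where
      i: "\<forall>t. \<forall>A\<subseteq>{1..d}. \<exists>\<alpha>. (\<forall>k\<le>d. \<alpha> k > 0) \<and>
        w + (t * sum \<omega> {..<d} - \<tau> + signs A d * \<alpha> d) *\<^sub>R c = (\<Sum>k\<le>d. \<alpha> k *\<^sub>R a i t (k, signs A k))"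
      by blast
    define g where "g A = pt i (tower_vertex (signs A))" for A
    have "inj_on g (Pow {1..d})"
    proof (intro inj_onI)
      fix A B assume AB: "A \<in> Pow {1..d}" "B \<in> Pow {1..d}" "g A = g B"
      then have "X i (tower_vertex (signs A)) = X i (tower_vertex (signs B))"
        using \<epsilon>(1) by (simp add: g_def pt_def)
      then have same: "tower_vertex (signs A) k = tower_vertex (signs B) k" if "k \<le> d" for k
        using X[OF that, of i] by metis
      \<comment> \<open>Each coordinate is its sign times a positive gap depending only on the
        previous coordinate, so equal vertices have equal signs.\<close>
      have "signs A k = signs B k" if "k \<in> {1..d}" for k
        using that
      proof (cases k)
        case (Suc m)
        with that same[of m] same[of k] tower_vertex_gap[of "signs A" m, OF signs]
        show ?thesis by simp
      qed simp
      then show "A = B"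
        using AB(1,2) by (force simp: signs_def split: if_splits)
    qed
    moreover have "{g A} \<in> parametric_faces P c w" if "A \<in> Pow {1..d}" for A
    proof -
      have A: "A \<subseteq> {1..d}" using that by simp
      let ?y = "tower_vertex (signs A)"
      have Y: "?y \<in> Y" using that by (simp add: Y_def)
      have "N j \<bullet> g A \<le> \<beta> j" if "j \<in> J" for j
      proof -
        from that consider "j = None" | k f where "j = Some (k, f)" "f \<in> ?F" by (auto simp: J_def)
        then show ?thesis
        proof cases
          case 1
          then show ?thesis using pt_bottom[OF Y, of i] by (simp add: g_def)
        next
          case (2 k f)
          then show ?thesis
            using pt_other[of i k f, OF _ _ Y] tower_vertex_feasible[of "signs A", OF signs 2(2)] \<epsilon>(1)
            by (cases "k = i") (auto simp: g_def pt_own less_imp_le)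
        qed
      qed
      then have gP: "g A \<in> P" by (simp add: P_def)
      obtain \<alpha> where \<alpha>: "\<And>k. k \<le> d \<Longrightarrow> \<alpha> k > 0" and
        eq: "w + (t i * sum \<omega> {..<d} - \<tau> + signs A d * \<alpha> d) *\<^sub>R c = (\<Sum>k\<le>d. \<alpha> k *\<^sub>R n i (k, signs A k))"
        using i[rule_format, OF A, of "t i"] unfolding n_def by blast
      \<comment> \<open>By \<open>eq\<close> this normal is \<open>w\<close> plus a multiple of
        \<open>c\<close>, and all normals in the combination are tight at
        \<open>g A\<close>.\<close>
      have "maximizers P (\<Sum>k\<le>d. \<alpha> k *\<^sub>R n i (k, signs A k)) = {g A}"
      proof (rule maximizers_eq_singleton[OF gP _ \<alpha> n_ker])
        fix k x assume "k \<le> d" "x \<in> P"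
        note f = facet_index_mem[of k d "signs A", OF \<open>k \<le> d\<close> signs_0[OF A] signs]
        show "n i (k, signs A k) \<bullet> x \<le> n i (k, signs A k) \<bullet> g A"
          using P_bounds[OF \<open>x \<in> P\<close> f, of i]
          by (simp add: g_def pt_own[OF f] tower_vertex_tight[of "signs A", OF signs_0[OF A] signs])
      qed auto
      then show ?thesis
        unfolding parametric_faces_def eq[symmetric] by blast
    qed
    ultimately show ?thesis by blast
  qed
  then show ?thesis
    using polytope card_J by (intro exI[of _ P]) (simp add: J_def)
qed

section \<open>Covering all directions\<close>

text \<open>Modulo \<open>1\<close>, every \<open>w\<close> whose largest entry has index \<open>\<pi> 0\<close> is \<open>- (\<Sum>k=1..d. \<beta> k *\<^sub>R axis (\<pi> k) 1)\<close> with
  \<open>\<beta> \<ge> 0\<close>. The frame is chosen such that its coefficients \<open>\<omega> k\<close> there are \<open>\<Sum>\<beta>\<close> plus the \<open>k\<close>-th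
  partial sum of \<open>\<beta>\<close>, hence positive and increasing.\<close>

definition difference_frame :: "nat \<Rightarrow> (nat \<Rightarrow> 'n::finite) \<Rightarrow> nat \<Rightarrow> real ^ 'n" where
  "difference_frame d \<pi> k =
     (if k = 0 then axis (\<pi> 1) 1 - 2 *\<^sub>R axis (\<pi> d) 1
      else if k < d then axis (\<pi> (Suc k)) 1 - axis (\<pi> k) 1 else 1)"

lemma inner_axis_one: "axis i 1 \<bullet> x = x $ i" for x :: "real ^ 'n"
  by (simp add: inner_axis')

text \<open>The differences make \<open>x\<close> constant on \<open>\<pi> 1\<close>, ...,
  \<open>\<pi> d\<close>; the vector of index 0 forces that constant to equal its double, and the
  all-ones vector then kills the entry at \<open>\<pi> 0\<close>.\<close>

lemma difference_frame_kernel: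
  fixes \<pi> :: "nat \<Rightarrow> 'n::finite"
  assumes "d \<ge> 1" and \<pi>: "bij_betw \<pi> {..d} UNIV"
    and zero: "\<And>k. k \<le> d \<Longrightarrow> difference_frame d \<pi> k \<bullet> x = 0"
  shows "x = 0"
proof -
  have step: "x $ \<pi> (Suc k) = x $ \<pi> k" if "0 < k" "k < d" for k
    using zero[of k] that by (simp add: difference_frame_def inner_diff_left inner_axis_one)
  have const: "x $ \<pi> (Suc k) = x $ \<pi> 1" if "Suc k \<le> d" for k
    using that by (induction k) (auto simp: step)
  have "x $ \<pi> d = x $ \<pi> 1"
    using const[of "d - 1"] assms(1) by simp
  moreover have "x $ \<pi> 1 = 2 * x $ \<pi> d"
    using zero[of 0] by (simp add: difference_frame_def inner_diff_left inner_axis_one)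
  ultimately have tail: "x $ \<pi> (Suc k) = 0" if "k < d" for k
    using const[of k] that by simp
  have "0 = (\<Sum>i\<in>UNIV. x $ i)"
    using zero[of d] assms(1) by (simp add: difference_frame_def inner_vec_def)
  also have "\<dots> = (\<Sum>k\<le>d. x $ \<pi> k)"
    using \<pi> by (rule sum.reindex_bij_betw[symmetric])
  also have "\<dots> = x $ \<pi> 0 + (\<Sum>k<d. x $ \<pi> (Suc k))"
    by (rule sum.atMost_shift)
  finally have head: "x $ \<pi> 0 = 0"
    by (simp add: tail)
  show ?thesis
    unfolding vec_eq_iff
  proof
    fix i
    obtain k where "k \<le> d" "i = \<pi> k"
      using \<pi> by (auto simp: bij_betw_def)
    then show "x $ i = 0 $ i"
      by (cases k) (auto simp: head tail)
  qed
qed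

lemma difference_frame_cover:
  fixes \<pi> :: "nat \<Rightarrow> 'n::finite" and w :: "real ^ 'n"
  assumes "d \<ge> 1" and \<pi>: "bij_betw \<pi> {..d} UNIV"
    and max: "\<And>i. w $ i \<le> w $ \<pi> 0" and w: "w \<notin> span {1}"
  shows "\<exists>\<omega> \<tau>. w = (\<Sum>k<d. \<omega> k *\<^sub>R difference_frame d \<pi> k) + \<tau> *\<^sub>R 1 \<and>
    0 < \<omega> 0 \<and> (\<forall>k. Suc k < d \<longrightarrow> \<omega> k \<le> \<omega> (Suc k))"
proof -
  define \<beta> where "\<beta> k = w $ \<pi> 0 - w $ \<pi> k" for k
  have \<beta>_nonneg: "0 \<le> \<beta> k" for k
    using max by (simp add: \<beta>_def)
  define \<omega> where "\<omega> k = sum \<beta> {1..d} + sum \<beta> {1..k}" for k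
  have \<omega>_Suc: "\<omega> (Suc k) = \<omega> k + \<beta> (Suc k)" for k
    by (simp add: \<omega>_def)
  define R where "R m = (\<Sum>k=1..m. \<beta> k *\<^sub>R (axis (\<pi> k) 1 :: real ^ 'n))" for m
  \<comment> \<open>Summation by parts: the increments of \<open>\<omega>\<close> are the
    \<open>\<beta> k\<close> collected in \<open>R m\<close>, with a boundary term at each
    end.\<close>
  have partial: "(\<Sum>k<Suc m. \<omega> k *\<^sub>R difference_frame d \<pi> k) =
      \<omega> m *\<^sub>R axis (\<pi> (Suc m)) 1 - R m - (2 * \<omega> 0) *\<^sub>R axis (\<pi> d) 1" if "m < d" for m
    using that
  proof (induction m)
    case 0
    then show ?case
      by (simp add: difference_frame_def R_def scaleR_diff_right mult.commute)
  next
    case (Suc m)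
    then have "(\<Sum>k<Suc (Suc m). \<omega> k *\<^sub>R difference_frame d \<pi> k) =
        \<omega> m *\<^sub>R axis (\<pi> (Suc m)) 1 - R m - (2 * \<omega> 0) *\<^sub>R axis (\<pi> d) 1 +
        \<omega> (Suc m) *\<^sub>R (axis (\<pi> (Suc (Suc m))) 1 - axis (\<pi> (Suc m)) 1)"
      by (subst sum.lessThan_Suc) (simp only: Suc.IH Suc_lessD, simp add: difference_frame_def)
    then show ?case
      by (simp add: \<omega>_Suc R_def algebra_simps)
  qed
  obtain m where m: "d = Suc m"
    using assms(1) by (cases d) auto
  \<comment> \<open>At the last index the full sum of \<open>\<beta>\<close> occurs twice, matching
    the coefficient 2 in the frame vector of index 0, so the boundary terms combine to the missing
    summand of \<open>R d\<close>.\<close>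
  have "\<omega> m + \<beta> d = 2 * \<omega> 0"
    using \<omega>_Suc[of m] by (simp add: m) (simp add: \<omega>_def m)
  then have sum_d: "\<omega> m *\<^sub>R axis (\<pi> d) 1 + \<beta> d *\<^sub>R axis (\<pi> d) 1 = (2 * \<omega> 0) *\<^sub>R (axis (\<pi> d) 1 :: real ^ 'n)"
    by (metis scaleR_add_left)
  have R_d: "R d = R m + \<beta> d *\<^sub>R axis (\<pi> d) 1"
    by (simp add: m R_def)
  have "\<omega> m *\<^sub>R axis (\<pi> d) 1 - R m - (2 * \<omega> 0) *\<^sub>R axis (\<pi> d) 1 = - R d"
    unfolding sum_d[symmetric] R_d by simp
  with partial[of m] have total: "(\<Sum>k<d. \<omega> k *\<^sub>R difference_frame d \<pi> k) = - R d"
    by (simp add: m)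
  have "w = - R d + (w $ \<pi> 0) *\<^sub>R 1"
    unfolding vec_eq_iff
  proof
    fix i
    obtain j where j: "j \<le> d" "i = \<pi> j"
      using \<pi> by (auto simp: bij_betw_def)
    have "R d $ i = (\<Sum>k=1..d. if k = j then \<beta> k else 0)"
      unfolding R_def sum_component
    proof (rule sum.cong)
      fix k assume "k \<in> {1..d}"
      with j \<pi> have "\<pi> k = i \<longleftrightarrow> k = j"
        by (auto simp: bij_betw_def inj_on_def)
      then show "(\<beta> k *\<^sub>R axis (\<pi> k) 1 :: real ^ 'n) $ i = (if k = j then \<beta> k else 0)"
        by (auto simp: axis_def)
    qed simp
    also have "\<dots> = \<beta> j"
      using j(1) by (auto simp: \<beta>_def not_less_eq_eq)
    finally show "w $ i = (- R d + (w $ \<pi> 0) *\<^sub>R 1) $ i"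
      by (simp add: \<beta>_def j(2))
  qed
  moreover have "0 < \<omega> 0"
  \<comment> \<open>Otherwise all \<open>\<beta> k\<close> vanish and \<open>w\<close> has equal
    entries, a multiple of the objective.\<close>
  proof (rule ccontr)
    assume "\<not> 0 < \<omega> 0"
    then have "sum \<beta> {1..d} = 0"
      using \<beta>_nonneg sum_nonneg[of "{1..d}" \<beta>] by (simp add: \<omega>_def)
    then have "R d = 0"
      unfolding R_def using \<beta>_nonneg by (intro sum.neutral) (simp add: sum_nonneg_eq_0_iff)
    with \<open>w = - R d + (w $ \<pi> 0) *\<^sub>R 1\<close> have "w = (w $ \<pi> 0) *\<^sub>R 1"
      by simp
    then have "w \<in> span {1}"
      by (metis span_base span_mul singletonI)
    with w show False by contradiction
  qed
  moreover have "\<omega> k \<le> \<omega> (Suc k)" for k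
    by (simp add: \<omega>_Suc \<beta>_nonneg)
  ultimately show ?thesis
    by (intro exI[of _ \<omega>] exI[of _ "w $ \<pi> 0"]) (simp add: total)
qed

theorem theorem1p1:
  fixes d :: nat
  assumes "d \<ge> 3" and "CARD('n::finite) = d + 1"
  shows "\<exists>(P :: (real ^ 'n) set) (c :: real ^ 'n).
           polytope P \<and> aff_dim P = int (d + 1) \<and>
           card {F. F facet_of P} = (2 * d + 1) * (d + 1) + 1 \<and>
           c \<noteq> 0 \<and>
           (\<forall>vs. coherent_monotone_path P c vs \<longrightarrow> path_length vs \<ge> 2 ^ (d - 1) - 1)"
proof -
  have d: "d \<ge> 1" using assms(1) by simp
  \<comment> \<open>The tower of index \<open>i\<close> is to serve the directions whose largest
    entry is the \<open>i\<close>-th, so its enumeration of the coordinates starts with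
    \<open>i\<close>.\<close>
  have "\<forall>i :: 'n. \<exists>\<pi>. bij_betw \<pi> {..d} UNIV \<and> \<pi> 0 = i"
  proof
    fix i :: 'n
    have "card {1..d} = card (UNIV - {i})"
      using assms(2) by simp
    then obtain \<pi> where \<pi>: "bij_betw \<pi> {1..d} (UNIV - {i})"
      by (metis bij_betw_iff_card finite finite_atLeastAtMost)
    let ?\<pi> = "\<pi>(0 := i)"
    have "bij_betw ?\<pi> {1..d} (UNIV - {i})"
      using \<pi> by (subst bij_betw_cong[of _ _ \<pi>]) auto
    then have "bij_betw ?\<pi> ({1..d} \<union> {0}) (UNIV - {i} \<union> {?\<pi> 0})"
      by (intro notIn_Un_bij_betw) auto
    moreover have "{1..d} \<union> {0} = {..d}" "UNIV - {i} \<union> {?\<pi> 0} = UNIV" by auto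
    ultimately have "bij_betw ?\<pi> {..d} UNIV" by (simp only:)
    moreover have "?\<pi> 0 = i" by simp
    ultimately show "\<exists>\<pi>. bij_betw \<pi> {..d} UNIV \<and> \<pi> 0 = i" by (intro exI[of _ ?\<pi>] conjI)
  qed
  from choice[OF this] obtain \<pi> where \<pi>: "\<And>i :: 'n. bij_betw (\<pi> i) {..d} UNIV" "\<And>i. \<pi> i 0 = i"
    by blast
  obtain P :: "(real ^ 'n) set" where P: "polytope P" "aff_dim P = DIM(real ^ 'n)"
    "card {F. F facet_of P} = CARD('n) * (2 * d + 1) + 1"
    and paths: "\<And>w. w \<notin> span {1} \<Longrightarrow>
      \<exists>g. inj_on g (Pow {1..d}) \<and> (\<forall>A\<in>Pow {1..d}. {g A} \<in> parametric_faces P 1 w)"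
  proof -
    have "\<exists>P :: (real ^ 'n) set. polytope P \<and> aff_dim P = DIM(real ^ 'n) \<and>
      card {F. F facet_of P} = CARD('n) * (2 * d + 1) + 1 \<and>
      (\<forall>w. w \<notin> span {1} \<longrightarrow>
        (\<exists>g. inj_on g (Pow {1..d}) \<and> (\<forall>A\<in>Pow {1..d}. {g A} \<in> parametric_faces P 1 w)))"
    proof (rule tower_polytope_exists[where e = "\<lambda>i. difference_frame d (\<pi> i)"])
      show "DIM(real ^ 'n) = Suc d" "1 \<le> d"
        using assms by simp_all
      show "difference_frame d (\<pi> i) d = 1" for i
        using d by (simp add: difference_frame_def)
      show "x = 0" if "\<And>k. k \<le> d \<Longrightarrow> difference_frame d (\<pi> i) k \<bullet> x = 0" for i x
        using difference_frame_kernel[OF d \<pi>(1)] that by blast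
    next
      fix w :: "real ^ 'n" assume w: "w \<notin> span {1}"
      obtain i where "\<And>j. w $ j \<le> w $ i"
        using Max_ge[of "range (($) w)"] Max_in[of "range (($) w)"] by fastforce
      with difference_frame_cover[OF d \<pi>(1)[of i], of w] w
      show "\<exists>i \<omega> \<tau>. w = (\<Sum>k<d. \<omega> k *\<^sub>R difference_frame d (\<pi> i) k) + \<tau> *\<^sub>R 1 \<and>
          0 < \<omega> 0 \<and> (\<forall>k. Suc k < d \<longrightarrow> \<omega> k \<le> \<omega> (Suc k))"
        unfolding \<pi>(2) by blast
    qed
    then show thesis using that by blast
  qed
  have "2 ^ (d - 1) - 1 \<le> path_length vs" if "coherent_monotone_path P 1 vs" for vs
  proof -
    have "card (Pow {1..d}) - 1 \<le> path_length vs"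
    proof (rule coherent_path_length_ge[OF that])
      fix w :: "real ^ 'n" assume "independent {w, 1}" "w \<noteq> 1"
      then have "w \<notin> span {1}" by (simp add: independent_insert)
      then show "\<exists>g. inj_on g (Pow {1..d}) \<and> (\<forall>A\<in>Pow {1..d}. {g A} \<in> parametric_faces P 1 w)"
        by (rule paths)
    qed
    \<comment> \<open>All \<open>2 ^ d\<close> vertices of one tower are visited, which gives twice
      the claimed order of growth.\<close>
    then have "2 ^ d - 1 \<le> path_length vs" by (simp add: card_Pow)
    moreover have "(2::nat) ^ (d - 1) \<le> 2 ^ d"
      by (intro power_increasing) auto
    ultimately show ?thesis by linarith
  qed
  moreover have "(1 :: real ^ 'n) \<noteq> 0" by simp
  ultimately show ?thesis
    using P assms(2) by (intro exI[of _ P] exI[of _ 1]) (simp add: algebra_simps)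
qed

end
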